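(* In the single-cell uplink with aged CSI and MRC receivers described in the context, for every $k\in\{1,\dots,K\}$ the achievable uplink rate of user $k$ satisfies $R_k^{\mathrm{a,mrc}}\ge\tilde R_k^{\mathrm{a,mrc}}$, where $$\tilde R_k^{\mathrm{a,mrc}}=\log_2\left(1+\frac{\alpha^2\tau p_u^2(M-1)\beta_k^2}{p_u(1+\tau p_u\beta_k)\sum_{i=1,i\ne k}^K\beta_i+(\tau+1)p_u\beta_k+1+b_{\mathrm{mrc}}}\right),\qquad b_{\mathrm{mrc}}=(1-\alpha^2)\tau p_u^2\beta_k^2.$$
   Context: System: a base station (BS) with $M$ antennas and $K\le M$ single-antenna users; $p_u>0$ is the transmit power per user, $\tau\ge K$ the (integer) training length, $p_p:=\tau p_u$, and $\beta_1,\dots,\beta_K>0$ are constants (large-scale fading). The channel vector of user $k$ at time $n$ is $\mathbf g_k[n]\in\mathbb C^M$ with i.i.d. $\mathcal{CN}(0,\beta_k)$ entries, independent across users. Estimation: the BS observes $\tilde{\mathbf y}_k[n]=\mathbf g_k[n]+\frac{1}{\sqrt{p_p}}\mathbf b_k[n]$, where the $\mathbf b_k[n]$ have i.i.d. $\mathcal{CN}(0,1)$ entries, are independent across $k$ and independent of the channels. The MMSE estimate is $\hat{\mathbf g}_k[n]=\frac{p_p\beta_k}{1+p_p\beta_k}\tilde{\mathbf y}_k[n]$; its entries are i.i.d. $\mathcal{CN}\left(0,\frac{p_p\beta_k^2}{1+p_p\beta_k}\right)$, independent across $k$. Aging: $\mathbf g_k[n+1]=\alpha\mathbf g_k[n]+\mathbf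 e_k[n+1]$, where $\alpha$ is real with $0\le|\alpha|\le1$ and $\mathbf e_k[n+1]$ is independent of the foregoing with i.i.d. $\mathcal{CN}(0,(1-\alpha^2)\beta_k)$ entries. The BS uses the aged CSI $\bar{\mathbf g}_k[n+1]=\alpha\hat{\mathbf g}_k[n]$. Rate: with linear detector vector $\hat{\mathbf a}_k$ for user $k$ (a function of $\bar{\mathbf g}_1[n+1],\dots,\bar{\mathbf g}_K[n+1]$), the achievable rate of user $k$ is defined as $$R_k=\mathrm E\left\{\log_2\left(1+\frac{p_u|\hat{\mathbf a}_k^\dagger\bar{\mathbf g}_k|^2}{p_u\sum_{i\ne k}|\hat{\mathbf a}_k^\dagger\bar{\mathbf g}_i|^2+\|\hat{\mathbf a}_k\|^2\left(p_u\sum_{i=1}^K\left(\beta_i-\alpha^2\frac{p_p\beta_i^2}{1+p_p\beta_i}\right)+1\right)}\right)\right\},$$ where $\bar{\mathbf g}_i=\bar{\mathbf g}_i[n+1]$, $^\dagger$ is conjugate transpose, and the fraction is read as $0$ when $\hat{\mathbf a}_k=0$. The MRC receiver is $\hat{\mathbf a}_k=\bar{\mathbf g}_k[n+1]$, and the resulting $R_k$ is denoted $R_k^{\mathrm{a,mrc}}$. *)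

theory Defs
  imports "HOL-Probability.Probability"
begin

text \<open>
  The antennas are indexed by a finite type \<open>'m\<close> and the users by a finite type \<open>'k\<close>, so that
  \<open>M = CARD('m)\<close> and \<open>K = CARD('k)\<close>. The vectors of all users at one time instant are collected
  in a value \<open>G\<close> of type \<open>complex^'m^'k\<close>, where \<open>G $ k\<close> is the vector of user \<open>k\<close>.
\<close>

text \<open>
  The law CN(0,v) of a circularly symmetric complex Gaussian: independent real and imaginary
  parts, each N(0,v/2). Scaling a standard pair, instead of using the density with
  variance \<open>v/2\<close>, makes \<open>v = 0\<close> the point mass at 0, as needed for the innovation
  when \<open>\<bar>\<alpha>\<bar> = 1\<close>.
\<close>
definition complex_normal :: "real \<Rightarrow> complex measure" where
  "complex_normal v =
     distr (density lborel std_normal_density \<Otimes>\<^sub>M density lborel std_normal_density) borel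
       (\<lambda>(x, y). Complex (sqrt (v / 2) * x) (sqrt (v / 2) * y))"

definition iid_complex_normal :: "'w measure \<Rightarrow> ('w \<Rightarrow> complex^'m) \<Rightarrow> real \<Rightarrow> bool" where
  "iid_complex_normal P X v \<longleftrightarrow>
     prob_space.indep_vars P (\<lambda>_. borel) (\<lambda>m \<omega>. X \<omega> $ m) UNIV \<and>
     (\<forall>m. distr P borel (\<lambda>\<omega>. X \<omega> $ m) = complex_normal v)"

definition indep_users :: "'w measure \<Rightarrow> ('w \<Rightarrow> complex^'m^'k) \<Rightarrow> bool" where
  "indep_users P G \<longleftrightarrow> prob_space.indep_vars P (\<lambda>_. borel) (\<lambda>k \<omega>. G \<omega> $ k) UNIV"

text \<open>
  Independence of two random variables with values in possibly different types; the library
  constant \<open>indep_var\<close> requires both to have the same value type. Compare the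
  library fact \<open>indep_var_eq\<close>.
\<close>
definition indep_pair ::
    "'w measure \<Rightarrow> 'a measure \<Rightarrow> ('w \<Rightarrow> 'a) \<Rightarrow> 'b measure \<Rightarrow> ('w \<Rightarrow> 'b) \<Rightarrow> bool" where
  "indep_pair P S X T Y \<longleftrightarrow>
     X \<in> P \<rightarrow>\<^sub>M S \<and> Y \<in> P \<rightarrow>\<^sub>M T \<and>
     prob_space.indep_set P {X -` A \<inter> space P | A. A \<in> sets S} {Y -` B \<inter> space P | B. B \<in> sets T}"

definition observation :: "real \<Rightarrow> complex^'m^'k \<Rightarrow> complex^'m^'k \<Rightarrow> complex^'m^'k" where
  "observation p\<^sub>p G B = (\<chi> k. G $ k + (1 / sqrt p\<^sub>p) *\<^sub>R (B $ k))"

definition mmse_estimate :: "real \<Rightarrow> ('k \<Rightarrow> real) \<Rightarrow> complex^'m^'k \<Rightarrow> complex^'m^'k" where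
  "mmse_estimate p\<^sub>p \<beta> Y = (\<chi> k. (p\<^sub>p * \<beta> k / (1 + p\<^sub>p * \<beta> k)) *\<^sub>R (Y $ k))"

definition aged_csi ::
    "real \<Rightarrow> real \<Rightarrow> ('k \<Rightarrow> real) \<Rightarrow> complex^'m^'k \<Rightarrow> complex^'m^'k \<Rightarrow> complex^'m^'k" where
  "aged_csi \<alpha> p\<^sub>p \<beta> G B = \<alpha> *\<^sub>R mmse_estimate p\<^sub>p \<beta> (observation p\<^sub>p G B)"

definition herm_prod :: "complex^'m \<Rightarrow> complex^'m \<Rightarrow> complex" where
  "herm_prod a x = (\<Sum>m\<in>UNIV. cnj (a $ m) * x $ m)"

text \<open>
  For \<open>a = 0\<close> numerator and denominator both vanish, and the quotient is 0.
\<close>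
definition sinr ::
    "real \<Rightarrow> real \<Rightarrow> real \<Rightarrow> ('k \<Rightarrow> real) \<Rightarrow> 'k \<Rightarrow> complex^'m \<Rightarrow> complex^'m^'k \<Rightarrow> real" where
  "sinr p\<^sub>u p\<^sub>p \<alpha> \<beta> k a G =
     p\<^sub>u * (cmod (herm_prod a (G $ k)))\<^sup>2 /
     (p\<^sub>u * (\<Sum>i\<in>UNIV - {k}. (cmod (herm_prod a (G $ i)))\<^sup>2) +
      (norm a)\<^sup>2 *
        (p\<^sub>u * (\<Sum>i\<in>UNIV. \<beta> i - \<alpha>\<^sup>2 * (p\<^sub>p * (\<beta> i)\<^sup>2 / (1 + p\<^sub>p * \<beta> i))) + 1))"

text \<open>
  A linear receiver \<open>A\<close> maps the available channel state information of all users to the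
  detector vectors of all users; \<open>G\<close> is the random aged channel state information.
\<close>
definition achievable_rate ::
    "'w measure \<Rightarrow> real \<Rightarrow> real \<Rightarrow> real \<Rightarrow> ('k \<Rightarrow> real) \<Rightarrow>
     (complex^'m^'k \<Rightarrow> complex^'m^'k) \<Rightarrow> ('w \<Rightarrow> complex^'m^'k) \<Rightarrow> 'k \<Rightarrow> real" where
  "achievable_rate P p\<^sub>u p\<^sub>p \<alpha> \<beta> A G k =
     (\<integral>\<omega>. log 2 (1 + sinr p\<^sub>u p\<^sub>p \<alpha> \<beta> k (A (G \<omega>) $ k) (G \<omega>)) \<partial>P)"

definition mrc_receiver :: "complex^'m^'k \<Rightarrow> complex^'m^'k" where
  "mrc_receiver G = G"

end

theory Submission
  imports Defs
begin

text \<open>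
  The entries of the aged estimate of user \<open>i\<close> are i.i.d. CN(0,\<open>s\<^sub>i\<close>), and the estimates of
  different users are independent. For maximum ratio combining with detector \<open>a\<close>, the reciprocal
  of the signal-to-noise ratio is a combination of \<open>1 / \<parallel>a\<parallel>\<^sup>2\<close> and of the interference terms
  \<open>\<bar>a\<^sup>\<dagger> g\<^sub>i\<bar>\<^sup>2 / \<parallel>a\<parallel>\<^sup>4\<close>. Since \<open>g\<^sub>i\<close> is independent of \<open>a\<close>, centred and uncorrelated, the latter have
  expectation \<open>s\<^sub>i\<close> times that of \<open>1 / \<parallel>a\<parallel>\<^sup>2\<close>. Writing \<open>1 / r\<close> as the integral of \<open>exp (- t r)\<close> over
  \<open>t \<ge> 0\<close> and using the Laplace transform \<open>(1 + t s\<^sub>k)\<^sup>-\<^sup>M\<close> of \<open>\<parallel>a\<parallel>\<^sup>2\<close> gives \<open>1 / ((M - 1) s\<^sub>k)\<close> for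
  the expectation of \<open>1 / \<parallel>a\<parallel>\<^sup>2\<close> when \<open>M \<ge> 2\<close>. The bound is then Jensen's inequality for the convex
  function \<open>x \<mapsto> log\<^sub>2 (1 + 1 / x)\<close>. For \<open>M = 1\<close> or \<open>\<alpha> = 0\<close> it is \<open>log\<^sub>2 1 = 0\<close>.
\<close>

subsection \<open>Independence\<close>

text \<open>Independence within each of two independent families passes to the family of pairs.
  Measurable rectangles form an intersection-stable generator, so the product formula has to be
  checked only there: independence of \<open>U\<close> and \<open>V\<close> splits an intersection
  of rectangle events into a \<open>U\<close> part and a \<open>V\<close> part, each part factors
  over \<open>I\<close>, and the factors are regrouped index by index. The lemma serves twice, with
  antennas and with users as indices.\<close>

lemma (in prob_space) indep_vars_Pair:
  assumes I: "finite I"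
    and X: "indep_vars N (\<lambda>i \<omega>. f i (U \<omega>)) I"
    and Y: "indep_vars L (\<lambda>i \<omega>. h i (V \<omega>)) I"
    and f: "\<And>i. i \<in> I \<Longrightarrow> f i \<in> S \<rightarrow>\<^sub>M N i"
    and h: "\<And>i. i \<in> I \<Longrightarrow> h i \<in> T \<rightarrow>\<^sub>M L i"
    and UV: "indep_var S U T V"
  shows "indep_vars (\<lambda>i. N i \<Otimes>\<^sub>M L i) (\<lambda>i \<omega>. (f i (U \<omega>), h i (V \<omega>))) I"
proof (cases "I = {}")
  case True
  then show ?thesis by (simp add: indep_vars_def indep_sets_def)
next
  case False
  have U: "random_variable S U" and V: "random_variable T V"
    using UV by (rule indep_var_rv1, rule indep_var_rv2)
  define E where "E i = {a \<times> b | a b. a \<in> sets (N i) \<and> b \<in> sets (L i)}" for i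
  show ?thesis
  proof (subst indep_vars_finite[OF False I, where E = E])
    show "\<forall>A\<in>Pi I E. prob (\<Inter>j\<in>I. (\<lambda>\<omega>. (f j (U \<omega>), h j (V \<omega>))) -` A j \<inter> space M) =
        (\<Prod>j\<in>I. prob ((\<lambda>\<omega>. (f j (U \<omega>), h j (V \<omega>))) -` A j \<inter> space M))"
    proof
      fix A assume "A \<in> Pi I E"
      then have "\<forall>i\<in>I. \<exists>a b. A i = a \<times> b \<and> a \<in> sets (N i) \<and> b \<in> sets (L i)"
        unfolding E_def by blast
      then obtain a b where ab: "\<And>i. i \<in> I \<Longrightarrow> A i = a i \<times> b i"
        "\<And>i. i \<in> I \<Longrightarrow> a i \<in> sets (N i)" "\<And>i. i \<in> I \<Longrightarrow> b i \<in> sets (L i)"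
        by metis
      \<comment> \<open>Pulling the sides of the rectangles back to \<open>S\<close> and
        \<open>T\<close> turns all events into events about \<open>U\<close> alone or
        \<open>V\<close> alone.\<close>
      define a' b' where "a' i = f i -` a i \<inter> space S" and "b' i = h i -` b i \<inter> space T" for i
      have a': "a' i \<in> sets S" and b': "b' i \<in> sets T" if "i \<in> I" for i
        unfolding a'_def b'_def using that f h ab by (auto intro: measurable_sets)
      have "prob (\<Inter>j\<in>I. (\<lambda>\<omega>. (f j (U \<omega>), h j (V \<omega>))) -` A j \<inter> space M)
          = prob ((\<lambda>x. (U x, V x)) -` ((\<Inter>j\<in>I. a' j) \<times> (\<Inter>j\<in>I. b' j)) \<inter> space M)"
        using False ab measurable_space[OF U] measurable_space[OF V]
        by (intro arg_cong[where f=prob]) (auto simp: a'_def b'_def)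
      also have "\<dots> = prob (U -` (\<Inter>j\<in>I. a' j) \<inter> space M) * prob (V -` (\<Inter>j\<in>I. b' j) \<inter> space M)"
        using False I a' b' by (intro indep_varD[OF UV] sets.finite_INT) auto
      also have "U -` (\<Inter>j\<in>I. a' j) \<inter> space M = (\<Inter>j\<in>I. (\<lambda>\<omega>. f j (U \<omega>)) -` a j \<inter> space M)"
        using False measurable_space[OF U] by (auto simp: a'_def)
      also have "prob \<dots> = (\<Prod>j\<in>I. prob ((\<lambda>\<omega>. f j (U \<omega>)) -` a j \<inter> space M))"
        by (rule indep_varsD_finite[OF X False I ab(2)])
      also have "V -` (\<Inter>j\<in>I. b' j) \<inter> space M = (\<Inter>j\<in>I. (\<lambda>\<omega>. h j (V \<omega>)) -` b j \<inter> space M)"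
        using False measurable_space[OF V] by (auto simp: b'_def)
      also have "prob \<dots> = (\<Prod>j\<in>I. prob ((\<lambda>\<omega>. h j (V \<omega>)) -` b j \<inter> space M))"
        by (rule indep_varsD_finite[OF Y False I ab(3)])
      also have "(\<Prod>j\<in>I. prob ((\<lambda>\<omega>. f j (U \<omega>)) -` a j \<inter> space M)) *
            (\<Prod>j\<in>I. prob ((\<lambda>\<omega>. h j (V \<omega>)) -` b j \<inter> space M)) =
          (\<Prod>j\<in>I. prob ((\<lambda>\<omega>. f j (U \<omega>)) -` a j \<inter> space M) * prob ((\<lambda>\<omega>. h j (V \<omega>)) -` b j \<inter> space M))"
        by (simp add: prod.distrib)
      \<comment> \<open>Independence of \<open>U\<close> and \<open>V\<close> is used a second time,
        now in the reverse direction and for each index separately.\<close>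
      also have "\<dots> = (\<Prod>j\<in>I. prob ((\<lambda>\<omega>. (f j (U \<omega>), h j (V \<omega>))) -` A j \<inter> space M))"
      proof (rule prod.cong)
        fix j assume j: "j \<in> I"
        have "prob ((\<lambda>\<omega>. (f j (U \<omega>), h j (V \<omega>))) -` A j \<inter> space M) =
            prob ((\<lambda>x. (U x, V x)) -` (a' j \<times> b' j) \<inter> space M)"
          using j ab measurable_space[OF U] measurable_space[OF V]
          by (intro arg_cong[where f=prob]) (auto simp: a'_def b'_def)
        also have "\<dots> = prob (U -` a' j \<inter> space M) * prob (V -` b' j \<inter> space M)"
          using j a' b' by (intro indep_varD[OF UV])
        also have "U -` a' j \<inter> space M = (\<lambda>\<omega>. f j (U \<omega>)) -` a j \<inter> space M"
          using measurable_space[OF U] by (auto simp: a'_def)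
        also have "V -` b' j \<inter> space M = (\<lambda>\<omega>. h j (V \<omega>)) -` b j \<inter> space M"
          using measurable_space[OF V] by (auto simp: b'_def)
        finally show "prob ((\<lambda>\<omega>. f j (U \<omega>)) -` a j \<inter> space M) *
            prob ((\<lambda>\<omega>. h j (V \<omega>)) -` b j \<inter> space M) =
            prob ((\<lambda>\<omega>. (f j (U \<omega>), h j (V \<omega>))) -` A j \<inter> space M)" ..
      qed simp
      finally show "prob (\<Inter>j\<in>I. (\<lambda>\<omega>. (f j (U \<omega>), h j (V \<omega>))) -` A j \<inter> space M) =
        (\<Prod>j\<in>I. prob ((\<lambda>\<omega>. (f j (U \<omega>), h j (V \<omega>))) -` A j \<inter> space M))" .
    qed
    show "sets (N i \<Otimes>\<^sub>M L i) = sigma_sets (space (N i \<Otimes>\<^sub>M L i)) (E i)" for i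
      unfolding E_def space_pair_measure by (rule sets_pair_measure)
    show "random_variable (N i \<Otimes>\<^sub>M L i) (\<lambda>\<omega>. (f i (U \<omega>), h i (V \<omega>)))" if "i \<in> I" for i
      using f[OF that] h[OF that] U V by measurable
    show "Int_stable (E i)" for i
      unfolding E_def by (rule Int_stable_pair_measure_generator)
    show "space (N i \<Otimes>\<^sub>M L i) \<in> E i" for i
      unfolding E_def space_pair_measure by auto
    show "E i \<subseteq> Pow (space (N i \<Otimes>\<^sub>M L i))" for i
      unfolding E_def space_pair_measure by (auto dest: sets.sets_into_space)
  qed
qed

text \<open>The restrictions of the family to the disjoint index sets \<open>{i}\<close> and
  \<open>{j}\<close> are independent; evaluation at \<open>i\<close> and \<open>j\<close> recovers
  the two variables.\<close>

lemma (in prob_space) indep_vars_imp_indep_var: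
  assumes X: "indep_vars N X I" and ij: "i \<in> I" "j \<in> I" "i \<noteq> j"
  shows "indep_var (N i) (X i) (N j) (X j)"
proof -
  have "indep_var (N i) ((\<lambda>f. f i) \<circ> (\<lambda>\<omega>. restrict (\<lambda>i. X i \<omega>) {i}))
      (N j) ((\<lambda>f. f j) \<circ> (\<lambda>\<omega>. restrict (\<lambda>i. X i \<omega>) {j}))"
    using ij by (intro indep_var_compose[OF indep_var_restrict[OF X]]) auto
  then show ?thesis by (simp add: comp_def)
qed

subsection \<open>Circularly symmetric complex Gaussians\<close>

abbreviation std_normal :: "real measure" where
  "std_normal \<equiv> density lborel (\<lambda>x. ennreal (std_normal_density x))"

interpretation std_normal: prob_space std_normal
  by (rule prob_space_normal_density) simp

interpretation std_normal_pair: pair_prob_space std_normal std_normal ..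

lemma prob_space_complex_normal: "prob_space (complex_normal v)"
  unfolding complex_normal_def
  by (intro std_normal_pair.prob_space_distr) (simp add: Complex_eq split_beta')

lemma sets_complex_normal [measurable_cong, simp]: "sets (complex_normal v) = sets borel"
  unfolding complex_normal_def by simp

lemma nn_integral_complex_normal:
  assumes [measurable]: "f \<in> borel_measurable borel"
  shows "(\<integral>\<^sup>+z. f z \<partial>complex_normal v) =
    (\<integral>\<^sup>+x. \<integral>\<^sup>+y. f (Complex (sqrt (v / 2) * x) (sqrt (v / 2) * y)) \<partial>std_normal \<partial>std_normal)"
  unfolding complex_normal_def
  by (subst nn_integral_distr)
    (simp_all add: split_beta' Complex_eq std_normal.nn_integral_fst[symmetric])

text \<open>The factor \<open>exp (- (s * x\<^sup>2))\<close> turns the standard normal density into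
  \<open>\<sigma>\<close> times a centred normal density of variance \<open>1 / (1 + 2 * s)\<close>,
  and that density has mass 1.\<close>

lemma nn_integral_std_normal_gaussian:
  assumes "0 \<le> s"
  shows "(\<integral>\<^sup>+x. ennreal (exp (- (s * x\<^sup>2))) \<partial>std_normal) = ennreal (1 / sqrt (1 + 2 * s))"
proof -
  define \<sigma> where "\<sigma> = 1 / sqrt (1 + 2 * s)"
  have \<sigma>: "\<sigma> > 0" and \<sigma>2: "\<sigma>\<^sup>2 = 1 / (1 + 2 * s)"
    using assms by (auto simp: \<sigma>_def power_divide)
  have eq: "std_normal_density x * exp (- (s * x\<^sup>2)) = \<sigma> * normal_density 0 \<sigma> x" for x
  proof -
    have "- x\<^sup>2 / 2 + - (s * x\<^sup>2) = - (x - 0)\<^sup>2 / (2 * \<sigma>\<^sup>2)"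
      using assms by (simp add: \<sigma>2 field_simps)
    moreover have "sqrt (2 * pi * \<sigma>\<^sup>2) = \<sigma> * sqrt (2 * pi)"
      using \<sigma> by (simp add: real_sqrt_mult)
    ultimately show ?thesis
      using \<sigma> by (simp add: normal_density_def std_normal_density_def mult_exp_exp)
  qed
  have "(\<integral>\<^sup>+x. ennreal (exp (- (s * x\<^sup>2))) \<partial>std_normal) =
      (\<integral>\<^sup>+x. ennreal (\<sigma> * normal_density 0 \<sigma> x) \<partial>lborel)"
    by (subst nn_integral_density) (simp_all add: eq[symmetric] ennreal_mult)
  also have "\<dots> = ennreal \<sigma>"
    using \<sigma> by (subst nn_integral_eq_integral) simp_all
  finally show ?thesis by (simp add: \<sigma>_def)
qed

text \<open>The Laplace transform of the squared modulus. It factors over real and imaginary part,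
  and each part contributes \<open>1 / sqrt (1 + t * v)\<close>.\<close>

lemma nn_integral_complex_normal_gaussian:
  assumes "0 \<le> t" "0 \<le> v"
  shows "(\<integral>\<^sup>+z. ennreal (exp (- (t * (cmod z)\<^sup>2))) \<partial>complex_normal v) = ennreal (1 / (1 + t * v))"
proof -
  define s where "s = t * v / 2"
  have s: "0 \<le> s" using assms by (simp add: s_def)
  have eq: "exp (- (t * (cmod (Complex (sqrt (v / 2) * x) (sqrt (v / 2) * y)))\<^sup>2)) =
      exp (- (s * x\<^sup>2)) * exp (- (s * y\<^sup>2))" for x y
    using assms by (simp add: cmod_power2 s_def mult_exp_exp power_mult_distrib field_simps)
  have "(\<integral>\<^sup>+z. ennreal (exp (- (t * (cmod z)\<^sup>2))) \<partial>complex_normal v) =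
     (\<integral>\<^sup>+x. \<integral>\<^sup>+y. ennreal (exp (- (s * x\<^sup>2))) * ennreal (exp (- (s * y\<^sup>2))) \<partial>std_normal \<partial>std_normal)"
    by (subst nn_integral_complex_normal) (simp_all add: eq ennreal_mult)
  also have "\<dots> = ennreal (1 / sqrt (1 + 2 * s)) * ennreal (1 / sqrt (1 + 2 * s))"
    by (simp add: nn_integral_cmult nn_integral_multc nn_integral_std_normal_gaussian[OF s])
  also have "\<dots> = ennreal (1 / (1 + 2 * s))"
    using s by (simp add: ennreal_mult[symmetric])
  finally show ?thesis by (simp add: s_def)
qed

lemma
  shows integrable_std_normal: "integrable std_normal (\<lambda>x. x)"
    and integral_std_normal: "(\<integral>x. x \<partial>std_normal) = 0"
    and integrable_std_normal_square: "integrable std_normal (\<lambda>x. x\<^sup>2)"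
    and integral_std_normal_square: "(\<integral>x. x\<^sup>2 \<partial>std_normal) = 1"
  using std_normal_moment_odd[of 0] std_normal_moment_even[of 1]
  by (auto simp: integrable_density integral_density has_bochner_integral_iff)

lemma distr_std_normal_pair:
  "distr (std_normal \<Otimes>\<^sub>M std_normal) std_normal fst = std_normal"
  "distr (std_normal \<Otimes>\<^sub>M std_normal) std_normal snd = std_normal"
proof -
  show fst: "distr (std_normal \<Otimes>\<^sub>M std_normal) std_normal fst = std_normal"
    by (rule std_normal.distr_pair_fst)
  then show "distr (std_normal \<Otimes>\<^sub>M std_normal) std_normal snd = std_normal"
    by (subst (asm) std_normal_pair.distr_pair_swap) (simp add: distr_distr comp_def split_beta')
qed

lemma has_bochner_integral_std_normal_pair:
  fixes f :: "real \<Rightarrow> real"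
  assumes "integrable std_normal f"
  shows "has_bochner_integral (std_normal \<Otimes>\<^sub>M std_normal) (\<lambda>p. f (fst p)) (integral\<^sup>L std_normal f)"
    and "has_bochner_integral (std_normal \<Otimes>\<^sub>M std_normal) (\<lambda>p. f (snd p)) (integral\<^sup>L std_normal f)"
proof -
  have [measurable]: "f \<in> borel_measurable borel"
    using borel_measurable_integrable[OF assms] by simp
  note 1 = distr_std_normal_pair(1) and 2 = distr_std_normal_pair(2)
  show "has_bochner_integral (std_normal \<Otimes>\<^sub>M std_normal) (\<lambda>p. f (fst p)) (integral\<^sup>L std_normal f)"
    using assms integrable_distr_eq[of fst "std_normal \<Otimes>\<^sub>M std_normal" std_normal f]
      integral_distr[of fst "std_normal \<Otimes>\<^sub>M std_normal" std_normal f]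
    by (simp add: 1 has_bochner_integral_iff)
  show "has_bochner_integral (std_normal \<Otimes>\<^sub>M std_normal) (\<lambda>p. f (snd p)) (integral\<^sup>L std_normal f)"
    using assms integrable_distr_eq[of snd "std_normal \<Otimes>\<^sub>M std_normal" std_normal f]
      integral_distr[of snd "std_normal \<Otimes>\<^sub>M std_normal" std_normal f]
    by (simp add: 2 has_bochner_integral_iff)
qed

lemma has_bochner_integral_complex_normal:
  "has_bochner_integral (complex_normal v) (\<lambda>z. z) 0"
proof -
  let ?Q = "std_normal \<Otimes>\<^sub>M std_normal"
  note std = has_bochner_integral_std_normal_pair[OF integrable_std_normal]
  have "has_bochner_integral ?Q (\<lambda>p. complex_of_real (sqrt (v / 2) * fst p) +
      \<i> * complex_of_real (sqrt (v / 2) * snd p)) (of_real (sqrt (v / 2) * 0) + \<i> * of_real (sqrt (v / 2) * 0))"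
    using std unfolding integral_std_normal
    by (intro has_bochner_integral_add has_bochner_integral_of_real has_bochner_integral_mult_right)
  then show ?thesis
    unfolding complex_normal_def
    by (intro has_bochner_integral_distr) (simp_all add: split_beta' Complex_eq)
qed

lemma has_bochner_integral_complex_normal_square:
  assumes "0 \<le> v"
  shows "has_bochner_integral (complex_normal v) (\<lambda>z. (cmod z)\<^sup>2) v"
proof -
  let ?Q = "std_normal \<Otimes>\<^sub>M std_normal"
  note std = has_bochner_integral_std_normal_pair[OF integrable_std_normal_square]
  have "has_bochner_integral ?Q (\<lambda>p. v / 2 * (fst p)\<^sup>2 + v / 2 * (snd p)\<^sup>2) (v / 2 * 1 + v / 2 * 1)"
    using std unfolding integral_std_normal_square
    by (intro has_bochner_integral_add has_bochner_integral_mult_right)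
  then show ?thesis
    unfolding complex_normal_def using assms
    by (intro has_bochner_integral_distr)
      (simp_all add: split_beta' Complex_eq cmod_power2 power_mult_distrib)
qed

text \<open>By stability of the normal law under independent sums, \<open>a * x + b * y\<close> has
  the law of a single standard normal scaled by \<open>sqrt (a\<^sup>2 + b\<^sup>2)\<close>. Nonzero
  coefficients keep all the laws involved nondegenerate, so that each has a density.\<close>

lemma nn_integral_std_normal_sum:
  assumes ab: "a \<noteq> 0" "b \<noteq> 0" and h[measurable]: "h \<in> borel_measurable borel"
  shows "(\<integral>\<^sup>+x. \<integral>\<^sup>+y. h (a * x + b * y) \<partial>std_normal \<partial>std_normal) =
    (\<integral>\<^sup>+x. h (sqrt (a\<^sup>2 + b\<^sup>2) * x) \<partial>std_normal)"
proof -
  let ?Q = "std_normal \<Otimes>\<^sub>M std_normal"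
  note 1 = distr_std_normal_pair(1) and 2 = distr_std_normal_pair(2)
  have "std_normal_pair.indep_var std_normal fst std_normal snd"
    by (subst std_normal_pair.indep_var_distribution_eq) (simp add: 1 2)
  from std_normal_pair.indep_var_compose[OF this, of "\<lambda>x. a * x" borel "\<lambda>x. b * x" borel]
  have indep: "std_normal_pair.indep_var borel (\<lambda>p. a * fst p) borel (\<lambda>p. b * snd p)"
    by (simp add: comp_def)
  have d1: "distributed ?Q lborel fst std_normal_density"
    using 1 unfolding distributed_def by (simp cong: distr_cong)
  have d2: "distributed ?Q lborel snd std_normal_density"
    using 2 unfolding distributed_def by (simp cong: distr_cong)
  have "distributed ?Q lborel (\<lambda>p. (0 + a * fst p)) (normal_density (0 + a * 0) (\<bar>a\<bar> * 1))"
    using d1 ab by (intro std_normal_pair.normal_density_affine) simp_all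
  moreover have "distributed ?Q lborel (\<lambda>p. (0 + b * snd p)) (normal_density (0 + b * 0) (\<bar>b\<bar> * 1))"
    using d2 ab by (intro std_normal_pair.normal_density_affine) simp_all
  ultimately have "distributed ?Q lborel (\<lambda>p. a * fst p + b * snd p)
      (normal_density (0 + 0) (sqrt (\<bar>a\<bar>\<^sup>2 + \<bar>b\<bar>\<^sup>2)))"
    using ab indep by (intro std_normal_pair.add_indep_normal) simp_all
  then have sum: "distr ?Q lborel (\<lambda>p. a * fst p + b * snd p) =
      density lborel (normal_density 0 (sqrt (a\<^sup>2 + b\<^sup>2)))"
    by (simp add: distributed_def)
  have pos: "0 < sqrt (a\<^sup>2 + b\<^sup>2)"
    using ab by (simp add: add_pos_pos)
  \<comment> \<open>The one-variable side has the same density, so both integrals are integrals of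
    \<open>h\<close> against the same law.\<close>
  have "distributed std_normal lborel (\<lambda>x. x) std_normal_density"
    unfolding distributed_def by (simp add: distr_id2)
  then have "distributed std_normal lborel (\<lambda>x. 0 + sqrt (a\<^sup>2 + b\<^sup>2) * x)
      (normal_density (0 + sqrt (a\<^sup>2 + b\<^sup>2) * 0) (\<bar>sqrt (a\<^sup>2 + b\<^sup>2)\<bar> * 1))"
    using pos by (intro std_normal.normal_density_affine) auto
  then have one: "distr std_normal lborel (\<lambda>x. sqrt (a\<^sup>2 + b\<^sup>2) * x) =
      density lborel (normal_density 0 (sqrt (a\<^sup>2 + b\<^sup>2)))"
    by (simp add: distributed_def)
  have "(\<integral>\<^sup>+x. \<integral>\<^sup>+y. h (a * x + b * y) \<partial>std_normal \<partial>std_normal) =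
      (\<integral>\<^sup>+p. h (a * fst p + b * snd p) \<partial>?Q)"
    by (simp add: std_normal.nn_integral_fst[symmetric])
  also have "\<dots> = (\<integral>\<^sup>+x. h x \<partial>distr ?Q lborel (\<lambda>p. a * fst p + b * snd p))"
    by (subst nn_integral_distr) simp_all
  also have "\<dots> = (\<integral>\<^sup>+x. h x \<partial>distr std_normal lborel (\<lambda>x. sqrt (a\<^sup>2 + b\<^sup>2) * x))"
    by (simp only: sum one)
  also have "\<dots> = (\<integral>\<^sup>+x. h (sqrt (a\<^sup>2 + b\<^sup>2) * x) \<partial>std_normal)"
    by (subst nn_integral_distr) simp_all
  finally show ?thesis .
qed

text \<open>Stability of the complex Gaussian law, obtained by applying the real statement to the
  imaginary parts and then to the real parts.\<close>

lemma nn_integral_complex_normal_sum: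
  assumes vw: "0 < v" "0 < w" and rq: "r \<noteq> 0" "q \<noteq> 0"
    and f[measurable]: "f \<in> borel_measurable borel"
  shows "(\<integral>\<^sup>+z. \<integral>\<^sup>+u. f (r *\<^sub>R z + q *\<^sub>R u) \<partial>complex_normal w \<partial>complex_normal v) =
    (\<integral>\<^sup>+z. f z \<partial>complex_normal (r\<^sup>2 * v + q\<^sup>2 * w))"
proof -
  interpret w: prob_space "complex_normal w" by (rule prob_space_complex_normal)
  define a b c where "a = r * sqrt (v / 2)" and "b = q * sqrt (w / 2)"
    and "c = sqrt ((r\<^sup>2 * v + q\<^sup>2 * w) / 2)"
  have ab: "a \<noteq> 0" "b \<noteq> 0" using vw rq by (auto simp: a_def b_def)
  have c: "sqrt (a\<^sup>2 + b\<^sup>2) = c"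
    using vw by (simp add: a_def b_def c_def power_mult_distrib field_simps)
  have eq: "r *\<^sub>R Complex (sqrt (v / 2) * x) (sqrt (v / 2) * y) +
      q *\<^sub>R Complex (sqrt (w / 2) * x') (sqrt (w / 2) * y') =
      Complex (a * x + b * x') (a * y + b * y')" for x y x' y'
    by (simp add: complex_eq_iff a_def b_def)
  define h where "h z = (\<integral>\<^sup>+x'. \<integral>\<^sup>+y'. f (r *\<^sub>R z +
      q *\<^sub>R Complex (sqrt (w / 2) * x') (sqrt (w / 2) * y')) \<partial>std_normal \<partial>std_normal)" for z
  have [measurable]: "h \<in> borel_measurable borel"
    unfolding h_def Complex_eq by measurable
  have "(\<integral>\<^sup>+z. \<integral>\<^sup>+u. f (r *\<^sub>R z + q *\<^sub>R u) \<partial>complex_normal w \<partial>complex_normal v) =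
      (\<integral>\<^sup>+z. h z \<partial>complex_normal v)"
    by (simp add: h_def nn_integral_complex_normal)
  also have "\<dots> = (\<integral>\<^sup>+x. \<integral>\<^sup>+y. \<integral>\<^sup>+x'. \<integral>\<^sup>+y'. f (Complex (a * x + b * x') (a * y + b * y'))
        \<partial>std_normal \<partial>std_normal \<partial>std_normal \<partial>std_normal)"
    by (subst nn_integral_complex_normal) (simp_all add: h_def eq)
  \<comment> \<open>Exchanging the two middle integrals makes the two real parts adjacent and the
    two imaginary parts adjacent, so that each pair can be merged.\<close>
  also have "\<dots> = (\<integral>\<^sup>+x. \<integral>\<^sup>+x'. \<integral>\<^sup>+y. \<integral>\<^sup>+y'. f (Complex (a * x + b * x') (a * y + b * y'))
        \<partial>std_normal \<partial>std_normal \<partial>std_normal \<partial>std_normal)"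
    by (rule nn_integral_cong, rule std_normal_pair.Fubini') (simp add: Complex_eq)
  also have "\<dots> = (\<integral>\<^sup>+x. \<integral>\<^sup>+x'. \<integral>\<^sup>+y. f (Complex (a * x + b * x') (c * y))
        \<partial>std_normal \<partial>std_normal \<partial>std_normal)"
    by (rule nn_integral_cong, rule nn_integral_cong)
      (rule nn_integral_std_normal_sum[OF ab, unfolded c], simp add: Complex_eq)
  also have "\<dots> = (\<integral>\<^sup>+x. \<integral>\<^sup>+y. f (Complex (c * x) (c * y)) \<partial>std_normal \<partial>std_normal)"
    by (rule nn_integral_std_normal_sum[OF ab, unfolded c]) (simp add: Complex_eq)
  also have "\<dots> = (\<integral>\<^sup>+z. f z \<partial>complex_normal (r\<^sup>2 * v + q\<^sup>2 * w))"
    by (simp add: nn_integral_complex_normal c_def)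
  finally show ?thesis .
qed

text \<open>Independence makes the joint law of \<open>X\<close> and \<open>Y\<close> a product
  measure; the previous integral identity, applied to indicator functions, then identifies the law
  of the combination.\<close>

lemma (in prob_space) distr_complex_normal_sum:
  assumes ind: "indep_var borel X borel Y"
    and X: "distr M borel X = complex_normal v" and Y: "distr M borel Y = complex_normal w"
    and vw: "0 < v" "0 < w" and rq: "r \<noteq> 0" "q \<noteq> 0"
  shows "distr M borel (\<lambda>\<omega>. r *\<^sub>R X \<omega> + q *\<^sub>R Y \<omega>) = complex_normal (r\<^sup>2 * v + q\<^sup>2 * w)"
proof (rule measure_eqI)
  interpret w: prob_space "complex_normal w" by (rule prob_space_complex_normal)
  have [measurable]: "random_variable borel X" "random_variable borel Y"
    using ind by (rule indep_var_rv1, rule indep_var_rv2)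
  have XY: "complex_normal v \<Otimes>\<^sub>M complex_normal w = distr M (borel \<Otimes>\<^sub>M borel) (\<lambda>\<omega>. (X \<omega>, Y \<omega>))"
    using ind unfolding indep_var_distribution_eq X Y by simp
  fix A assume "A \<in> sets (distr M borel (\<lambda>\<omega>. r *\<^sub>R X \<omega> + q *\<^sub>R Y \<omega>))"
  then have [measurable]: "A \<in> sets borel" by simp
  have "emeasure (distr M borel (\<lambda>\<omega>. r *\<^sub>R X \<omega> + q *\<^sub>R Y \<omega>)) A =
      (\<integral>\<^sup>+\<omega>. indicator A (r *\<^sub>R X \<omega> + q *\<^sub>R Y \<omega>) \<partial>M)"
    by (subst nn_integral_distr[symmetric, where f = "indicator A" and M' = borel]) simp_all
  also have "\<dots> = (\<integral>\<^sup>+p. indicator A (r *\<^sub>R fst p + q *\<^sub>R snd p) \<partial>(complex_normal v \<Otimes>\<^sub>M complex_normal w))"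
    unfolding XY by (subst nn_integral_distr) simp_all
  also have "\<dots> = (\<integral>\<^sup>+z. \<integral>\<^sup>+u. indicator A (r *\<^sub>R z + q *\<^sub>R u) \<partial>complex_normal w \<partial>complex_normal v)"
    by (simp add: w.nn_integral_fst[symmetric])
  also have "\<dots> = emeasure (complex_normal (r\<^sup>2 * v + q\<^sup>2 * w)) A"
    by (subst nn_integral_complex_normal_sum[OF vw rq]) simp_all
  finally show "emeasure (distr M borel (\<lambda>\<omega>. r *\<^sub>R X \<omega> + q *\<^sub>R Y \<omega>)) A =
    emeasure (complex_normal (r\<^sup>2 * v + q\<^sup>2 * w)) A" .
qed simp

section \<open>Half-line integrals that reduce inverse moments to Laplace transforms\<close>

text \<open>The case \<open>r = 0\<close> is included: both sides are then infinite. This allows the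
  formula to be used before a random norm is known to be nonzero almost everywhere.\<close>

lemma nn_integral_exp_decay:
  assumes "0 \<le> r"
  shows "(\<integral>\<^sup>+t. ennreal (exp (- (t * r))) * indicator {0..} t \<partial>lborel) = inverse (ennreal r)"
proof (cases "r = 0")
  case True
  have "emeasure lborel {0::real..} = \<infinity>"
  proof (rule ccontr)
    assume "emeasure lborel {0::real..} \<noteq> \<infinity>"
    then obtain c where c: "emeasure lborel {0::real..} = ennreal c" "0 \<le> c"
      by (cases "emeasure lborel {0::real..}") auto
    \<comment> \<open>An interval longer than the supposed finite measure \<open>c\<close> still
      fits into the half-line.\<close>
    have "emeasure lborel {0..c + 1} \<le> emeasure lborel {0::real..}"
      by (intro emeasure_mono) auto
    with c show False by simp
  qed
  with True show ?thesis by simp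
next
  case False
  with assms have r: "0 < r" by simp
  have lim: "((\<lambda>t. - exp (- (t * r)) / r) \<longlongrightarrow> 0) at_top"
    using r by real_asymp
  have "(\<integral>\<^sup>+t. ennreal (exp (- (t * r))) * indicator {0..} t \<partial>lborel) = ennreal (0 - (- exp (- (0 * r)) / r))"
    by (rule nn_integral_FTC_atLeast[OF _ _ _ lim])
      (use r in \<open>auto intro!: derivative_eq_intros simp: field_simps\<close>)
  then show ?thesis using r by (simp add: inverse_ennreal divide_inverse)
qed

text \<open>With M antennas the exponent is M = m + 2. Being at least 2, it makes the integral
  finite, and the antiderivative \<open>?F\<close> produces the factor M - 1 =
  \<open>Suc m\<close>.\<close>

lemma nn_integral_inverse_power_decay:
  assumes v: "0 < v"
  shows "(\<integral>\<^sup>+t. ennreal (1 / (1 + t * v) ^ Suc (Suc m)) * indicator {0..} t \<partial>lborel) =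
    ennreal (1 / (real (Suc m) * v))"
proof -
  let ?F = "\<lambda>t. - 1 / (real (Suc m) * v * (1 + t * v) ^ Suc m)"
  have lim: "(?F \<longlongrightarrow> 0) at_top"
  proof -
    have "filterlim (\<lambda>t. 1 + t * v) at_top at_top"
      using v by real_asymp
    then have "filterlim (\<lambda>t. (1 + t * v) ^ Suc m) at_top at_top"
      by (intro filterlim_pow_at_top) simp_all
    then have "((\<lambda>t. inverse ((1 + t * v) ^ Suc m)) \<longlongrightarrow> 0) at_top"
      by (rule tendsto_inverse_0_at_top)
    from tendsto_mult_left[OF this, of "- 1 / (real (Suc m) * v)"] show ?thesis
      by (simp add: divide_inverse mult_ac)
  qed
  have deriv: "DERIV ?F t :> 1 / (1 + t * v) ^ Suc (Suc m)" if "0 \<le> t" for t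
  proof -
    have p: "0 < 1 + t * v" using v that by (simp add: add_pos_nonneg)
    have "((\<lambda>t. (1 + t * v) ^ Suc m) has_real_derivative real (Suc m) * (v * (1 + t * v) ^ m)) (at t)"
      by (rule derivative_eq_intros refl | simp)+
    then have "((\<lambda>t. inverse ((1 + t * v) ^ Suc m)) has_real_derivative
        - (inverse ((1 + t * v) ^ Suc m) * (real (Suc m) * (v * (1 + t * v) ^ m)) * inverse ((1 + t * v) ^ Suc m))) (at t)"
      by (rule DERIV_inverse') (use p in simp)
    from DERIV_cmult[OF this, of "- 1 / (real (Suc m) * v)"]
    show ?thesis
      using p v by (rule_tac DERIV_cong) (auto simp: divide_simps)
  qed
  have "(\<integral>\<^sup>+t. ennreal (1 / (1 + t * v) ^ Suc (Suc m)) * indicator {0..} t \<partial>lborel) = ennreal (0 - ?F 0)"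
    by (rule nn_integral_FTC_atLeast[OF _ deriv _ lim]) (use v in simp_all)
  then show ?thesis by simp
qed

subsection \<open>Gaussian vectors\<close>

lemma borel_measurable_vec_nth [measurable (raw)]:
  fixes X :: "'a \<Rightarrow> 'b::euclidean_space^'m"
  assumes "X \<in> borel_measurable M"
  shows "(\<lambda>\<omega>. X \<omega> $ i) \<in> borel_measurable M"
  using assms by (rule borel_measurable_continuous_on[rotated]) (intro continuous_intros)

lemma borel_measurable_cnj [measurable (raw)]:
  assumes "X \<in> borel_measurable M"
  shows "(\<lambda>\<omega>. cnj (X \<omega>)) \<in> borel_measurable M"
  using assms by (rule borel_measurable_continuous_on[rotated]) (intro continuous_intros)

lemma borel_measurable_vec:
  fixes X :: "'a \<Rightarrow> 'b::euclidean_space^'m"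
  assumes [measurable]: "\<And>i. (\<lambda>\<omega>. X \<omega> $ i) \<in> borel_measurable M"
  shows "X \<in> borel_measurable M"
  by (subst borel_measurable_euclidean_space) (auto simp: Basis_vec_def inner_axis)

lemma norm_vec_square: "(norm (x :: complex^'m))\<^sup>2 = (\<Sum>m\<in>UNIV. (cmod (x $ m))\<^sup>2)"
  by (simp add: norm_vec_def L2_set_def sum_nonneg)

lemma has_bochner_integral_distrD:
  fixes f :: "'b \<Rightarrow> 'c::{banach, second_countable_topology}"
  assumes "has_bochner_integral (distr M N g) f x" "g \<in> M \<rightarrow>\<^sub>M N" "f \<in> borel_measurable N"
  shows "has_bochner_integral M (\<lambda>x. f (g x)) x"
  using assms by (simp add: has_bochner_integral_iff integrable_distr_eq integral_distr)

context prob_space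
begin

lemma iid_complex_normal_measurable:
  assumes "iid_complex_normal M X v"
  shows "random_variable borel X"
proof (rule borel_measurable_vec)
  show "random_variable borel (\<lambda>\<omega>. X \<omega> $ m)" for m
    using assms by (simp add: iid_complex_normal_def indep_vars_def)
qed

text \<open>The covariance matrix is \<open>v\<close> times the identity: distinct entries are
  independent and centred, so their mixed moments vanish.\<close>

lemma iid_complex_normal_moments:
  fixes X :: "'a \<Rightarrow> complex^'m"
  assumes X: "iid_complex_normal M X v" and v: "0 \<le> v"
  shows "has_bochner_integral M (\<lambda>\<omega>. X \<omega> $ m) 0"
    and "has_bochner_integral M (\<lambda>\<omega>. (cmod (X \<omega> $ m))\<^sup>2) v"
    and "has_bochner_integral M (\<lambda>\<omega>. X \<omega> $ m * cnj (X \<omega> $ m')) (if m = m' then of_real v else 0)"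
proof -
  have [measurable]: "random_variable borel X"
    using X by (rule iid_complex_normal_measurable)
  have d: "distr M borel (\<lambda>\<omega>. X \<omega> $ m) = complex_normal v" for m
    using X by (simp add: iid_complex_normal_def)
  have 1: "has_bochner_integral M (\<lambda>\<omega>. X \<omega> $ m) 0" for m
    by (rule has_bochner_integral_distrD[where f = "\<lambda>z. z" and N = borel])
      (simp_all add: d has_bochner_integral_complex_normal)
  have 2: "has_bochner_integral M (\<lambda>\<omega>. (cmod (X \<omega> $ m))\<^sup>2) v" for m
    by (rule has_bochner_integral_distrD[where f = "\<lambda>z. (cmod z)\<^sup>2" and N = borel])
      (simp_all add: d has_bochner_integral_complex_normal_square[OF v])
  show "has_bochner_integral M (\<lambda>\<omega>. X \<omega> $ m) 0"
    and "has_bochner_integral M (\<lambda>\<omega>. (cmod (X \<omega> $ m))\<^sup>2) v"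
    by (rule 1, rule 2)
  show "has_bochner_integral M (\<lambda>\<omega>. X \<omega> $ m * cnj (X \<omega> $ m')) (if m = m' then of_real v else 0)"
  proof (cases "m = m'")
    case True
    then show ?thesis
      using has_bochner_integral_of_real[OF 2[of m], where 'a = complex]
      unfolding complex_norm_square by simp
  next
    case False
    have "indep_var borel (\<lambda>\<omega>. X \<omega> $ m) borel (\<lambda>\<omega>. X \<omega> $ m')"
      using X False unfolding iid_complex_normal_def
      by (intro indep_vars_imp_indep_var[where I = UNIV]) auto
    from indep_var_compose[OF this, of "\<lambda>z. z" borel cnj borel]
    have ind: "indep_var borel (\<lambda>\<omega>. X \<omega> $ m) borel (\<lambda>\<omega>. cnj (X \<omega> $ m'))"
      by (simp add: comp_def)
    have "integrable M (\<lambda>\<omega>. X \<omega> $ m)" "integrable M (\<lambda>\<omega>. cnj (X \<omega> $ m'))" "expectation (\<lambda>\<omega>. X \<omega> $ m) = 0"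
      using 1[of m] 1[of m'] by (auto simp: has_bochner_integral_iff)
    with indep_var_integrable[OF ind] indep_var_lebesgue_integral[OF ind] False
    show ?thesis by (simp add: has_bochner_integral_iff)
  qed
qed

text \<open>The squared norm is a sum of independent squared moduli, so its Laplace transform is a
  product of equal factors, one per antenna.\<close>

lemma nn_integral_iid_complex_normal_gaussian:
  fixes X :: "'a \<Rightarrow> complex^'m"
  assumes X: "iid_complex_normal M X v" and v: "0 \<le> v" and t: "0 \<le> t"
  shows "(\<integral>\<^sup>+\<omega>. ennreal (exp (- (t * (norm (X \<omega>))\<^sup>2))) \<partial>M) = ennreal (1 / (1 + t * v) ^ CARD('m))"
proof -
  have [measurable]: "random_variable borel X"
    using X by (rule iid_complex_normal_measurable)
  let ?E = "\<lambda>z. ennreal (exp (- (t * (cmod z)\<^sup>2)))"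
  have ind: "indep_vars (\<lambda>_. borel) (\<lambda>m \<omega>. ?E (X \<omega> $ m)) UNIV"
    using X unfolding iid_complex_normal_def
    by (intro indep_vars_compose2[where Y = "\<lambda>_. ?E" and M' = "\<lambda>_. borel"]) auto
  have "(\<integral>\<^sup>+\<omega>. ennreal (exp (- (t * (norm (X \<omega>))\<^sup>2))) \<partial>M) = (\<integral>\<^sup>+\<omega>. (\<Prod>m\<in>UNIV. ?E (X \<omega> $ m)) \<partial>M)"
  proof (rule nn_integral_cong)
    fix \<omega>
    have "- (t * (norm (X \<omega>))\<^sup>2) = (\<Sum>m\<in>UNIV. - (t * (cmod (X \<omega> $ m))\<^sup>2))"
      by (simp add: norm_vec_square sum_distrib_left sum_negf)
    then show "ennreal (exp (- (t * (norm (X \<omega>))\<^sup>2))) = (\<Prod>m\<in>UNIV. ?E (X \<omega> $ m))"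
      by (simp only: exp_sum finite) (simp add: prod_ennreal)
  qed
  also have "\<dots> = (\<Prod>m\<in>UNIV. \<integral>\<^sup>+\<omega>. ?E (X \<omega> $ m) \<partial>M)"
    using ind by (intro indep_vars_nn_integral) auto
  also have "\<dots> = (\<Prod>m\<in>(UNIV::'m set). ennreal (1 / (1 + t * v)))"
  proof (rule prod.cong)
    fix m :: 'm
    have "(\<integral>\<^sup>+\<omega>. ?E (X \<omega> $ m) \<partial>M) = (\<integral>\<^sup>+z. ?E z \<partial>distr M borel (\<lambda>\<omega>. X \<omega> $ m))"
      by (subst nn_integral_distr) simp_all
    also have "\<dots> = ennreal (1 / (1 + t * v))"
      using X t v unfolding iid_complex_normal_def by (simp add: nn_integral_complex_normal_gaussian)
    finally show "(\<integral>\<^sup>+\<omega>. ?E (X \<omega> $ m) \<partial>M) = ennreal (1 / (1 + t * v))" .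
  qed simp
  also have "\<dots> = ennreal (1 / (1 + t * v) ^ CARD('m))"
    using t v by (simp add: ennreal_power power_one_over)
  finally show ?thesis .
qed

section \<open>Inverse moments of the detector and the mean of the interference\<close>

text \<open>Working with extended nonnegative reals lets Tonelli exchange the expectation with the
  integral over \<open>t\<close> without any prior integrability or nonvanishing statement.\<close>

lemma nn_integral_inverse_norm_square:
  fixes X :: "'a \<Rightarrow> complex^'m"
  assumes X: "iid_complex_normal M X v" and v: "0 < v" and card: "2 \<le> CARD('m)"
  shows "(\<integral>\<^sup>+\<omega>. inverse (ennreal ((norm (X \<omega>))\<^sup>2)) \<partial>M) = ennreal (1 / ((real CARD('m) - 1) * v))"
proof -
  have [measurable]: "random_variable borel X"
    using X by (rule iid_complex_normal_measurable)
  interpret lb: pair_sigma_finite M "lborel :: real measure" ..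
  obtain m where m: "CARD('m) = Suc (Suc m)"
    using le_Suc_ex[OF card] by auto
  have "(\<integral>\<^sup>+\<omega>. inverse (ennreal ((norm (X \<omega>))\<^sup>2)) \<partial>M) =
      (\<integral>\<^sup>+\<omega>. \<integral>\<^sup>+t. ennreal (exp (- (t * (norm (X \<omega>))\<^sup>2))) * indicator {0..} t \<partial>lborel \<partial>M)"
    by (simp add: nn_integral_exp_decay)
  also have "\<dots> = (\<integral>\<^sup>+t. \<integral>\<^sup>+\<omega>. ennreal (exp (- (t * (norm (X \<omega>))\<^sup>2))) * indicator {0..} t \<partial>M \<partial>lborel)"
    by (rule lb.Fubini'[symmetric]) measurable
  also have "\<dots> = (\<integral>\<^sup>+t. ennreal (1 / (1 + t * v) ^ Suc (Suc m)) * indicator {0..} t \<partial>lborel)"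
    using v by (intro nn_integral_cong)
      (auto simp: nn_integral_multc nn_integral_iid_complex_normal_gaussian[OF X] m indicator_def
        simp del: power_Suc)
  also have "\<dots> = ennreal (1 / ((real CARD('m) - 1) * v))"
    by (subst nn_integral_inverse_power_decay[OF v]) (simp add: m)
  finally show ?thesis .
qed

text \<open>The extended inverse of 0 is infinite, so a finite integral of the inverse forces
  \<open>X\<close> to be nonzero almost everywhere. The real quotient, which is 0 at
  \<open>X \<omega> = 0\<close>, therefore agrees almost everywhere with the extended
  inverse.\<close>

lemma
  fixes X :: "'a \<Rightarrow> complex^'m"
  assumes X: "iid_complex_normal M X v" and v: "0 < v" and card: "2 \<le> CARD('m)"
  shows AE_iid_complex_normal_nonzero: "AE \<omega> in M. X \<omega> \<noteq> 0"
    and has_bochner_integral_inverse_norm_square: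
      "has_bochner_integral M (\<lambda>\<omega>. 1 / (norm (X \<omega>))\<^sup>2) (1 / ((real CARD('m) - 1) * v))"
proof -
  have [measurable]: "random_variable borel X"
    using X by (rule iid_complex_normal_measurable)
  note nn = nn_integral_inverse_norm_square[OF assms]
  have "AE \<omega> in M. inverse (ennreal ((norm (X \<omega>))\<^sup>2)) \<noteq> \<infinity>"
    by (rule nn_integral_noteq_infinite) (simp_all add: nn)
  then show AE: "AE \<omega> in M. X \<omega> \<noteq> 0"
    by eventually_elim auto
  have "(\<integral>\<^sup>+\<omega>. ennreal (1 / (norm (X \<omega>))\<^sup>2) \<partial>M) = (\<integral>\<^sup>+\<omega>. inverse (ennreal ((norm (X \<omega>))\<^sup>2)) \<partial>M)"
    using AE by (intro nn_integral_cong_AE) (auto simp: inverse_ennreal divide_inverse)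
  then show "has_bochner_integral M (\<lambda>\<omega>. 1 / (norm (X \<omega>))\<^sup>2) (1 / ((real CARD('m) - 1) * v))"
    using nn v card by (intro has_bochner_integral_nn_integral) auto
qed

text \<open>For a fixed value x of \<open>X\<close>, the product with \<open>Y\<close> has second
  moment s times the squared norm of x. To avoid conditioning, the squared modulus is expanded into
  products of a function of \<open>X\<close> and a function of \<open>Y\<close>, which factor under
  the expectation by independence.\<close>

lemma has_bochner_integral_herm_prod:
  fixes X Y :: "'a \<Rightarrow> complex^'m"
  assumes ind: "indep_var borel X borel Y"
    and Y: "iid_complex_normal M Y s" and s: "0 \<le> s"
    and int: "has_bochner_integral M (\<lambda>\<omega>. 1 / (norm (X \<omega>))\<^sup>2) c"
  shows "has_bochner_integral M (\<lambda>\<omega>. (cmod (herm_prod (X \<omega>) (Y \<omega>)))\<^sup>2 / (norm (X \<omega>)) ^ 4) (s * c)"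
proof -
  have [measurable]: "random_variable borel X" "random_variable borel Y"
    using ind by (rule indep_var_rv1, rule indep_var_rv2)
  define f where "f m m' x = cnj (x $ m) * x $ m' / of_real (norm x ^ 4)" for m m' and x :: "complex^'m"
  have [measurable]: "f m m' \<in> borel_measurable borel" for m m'
    unfolding f_def by measurable
  have f_int: "integrable M (\<lambda>\<omega>. f m m' (X \<omega>))" for m m'
  proof (rule Bochner_Integration.integrable_bound)
    show "integrable M (\<lambda>\<omega>. 1 / (norm (X \<omega>))\<^sup>2)"
      using int by (simp add: has_bochner_integral_iff)
    \<comment> \<open>Each normalised coefficient is dominated by the inverse squared norm, which is
      integrable by assumption; at \<open>x = 0\<close> both sides are 0 by the convention for
      division.\<close>
    have "norm (f m m' x) \<le> 1 / (norm x)\<^sup>2" for x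
    proof (cases "x = 0")
      case False
      have "cmod (x $ m) * cmod (x $ m') \<le> norm x * norm x"
        by (intro mult_mono Finite_Cartesian_Product.norm_nth_le) auto
      then have "norm (f m m' x) \<le> norm x * norm x / norm x ^ 4"
        unfolding f_def by (simp add: norm_mult norm_divide divide_right_mono norm_power)
      also have "\<dots> = 1 / (norm x)\<^sup>2"
        using False by (simp add: field_simps power2_eq_square power4_eq_xxxx)
      finally show ?thesis .
    qed (simp add: f_def)
    then show "AE \<omega> in M. norm (f m m' (X \<omega>)) \<le> norm (1 / (norm (X \<omega>))\<^sup>2)" by simp
  qed simp
  have bilinear: "has_bochner_integral M (\<lambda>\<omega>. f m m' (X \<omega>) * (Y \<omega> $ m * cnj (Y \<omega> $ m')))
      (expectation (\<lambda>\<omega>. f m m' (X \<omega>)) * (if m = m' then of_real s else 0))" for m m'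
  proof -
    have i: "indep_var borel (\<lambda>\<omega>. f m m' (X \<omega>)) borel (\<lambda>\<omega>. Y \<omega> $ m * cnj (Y \<omega> $ m'))"
      using indep_var_compose[OF ind, of "f m m'" borel "\<lambda>y. y $ m * cnj (y $ m')" borel]
      by (simp add: comp_def)
    show ?thesis
      using iid_complex_normal_moments(3)[OF Y s, of m m'] f_int[of m m']
        indep_var_integrable[OF i] indep_var_lebesgue_integral[OF i]
      by (simp add: has_bochner_integral_iff)
  qed
  have expand: "(\<Sum>m\<in>UNIV. \<Sum>m'\<in>UNIV. f m m' x * (y $ m * cnj (y $ m'))) =
      of_real ((cmod (herm_prod x y))\<^sup>2 / norm x ^ 4)" for x y
  proof -
    have "of_real ((cmod (herm_prod x y))\<^sup>2) = (\<Sum>m\<in>UNIV. \<Sum>m'\<in>UNIV. (cnj (x $ m) * y $ m) * (x $ m' * cnj (y $ m')))"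
      unfolding complex_norm_square herm_prod_def cnj_sum complex_cnj_mult complex_cnj_cnj sum_product ..
    then show ?thesis
      by (simp add: f_def sum_divide_distrib mult_ac)
  qed
  have diag: "(\<Sum>m\<in>UNIV. f m m x) = of_real (1 / (norm x)\<^sup>2)" for x
  proof -
    have "(\<Sum>m\<in>UNIV. f m m x) = of_real ((norm x)\<^sup>2) / of_real (norm x ^ 4)"
      unfolding norm_vec_square of_real_sum complex_norm_square
      by (simp add: f_def sum_divide_distrib mult_ac)
    also have "\<dots> = of_real (1 / (norm x)\<^sup>2)"
      by (cases "x = 0") (simp_all add: field_simps power2_eq_square power4_eq_xxxx)
    finally show ?thesis .
  qed
  \<comment> \<open>Only the diagonal of the covariance survives, and by \<open>diag\<close> the
    diagonal coefficients add up to the inverse squared norm.\<close>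
  have "(\<Sum>m\<in>UNIV. \<Sum>m'\<in>UNIV. expectation (\<lambda>\<omega>. f m m' (X \<omega>)) * (if m = m' then of_real s else 0)) =
      (\<Sum>m\<in>UNIV. expectation (\<lambda>\<omega>. f m m (X \<omega>))) * of_real s"
    by (simp add: sum_distrib_right if_distrib cong: if_cong)
  also have "(\<Sum>m\<in>UNIV. expectation (\<lambda>\<omega>. f m m (X \<omega>))) = expectation (\<lambda>\<omega>. of_real (1 / (norm (X \<omega>))\<^sup>2))"
    by (simp only: diag[symmetric] Bochner_Integration.integral_sum[OF f_int])
  also have "\<dots> = complex_of_real c"
    using int by (subst integral_complex_of_real) (simp add: has_bochner_integral_iff)
  finally have val: "(\<Sum>m\<in>UNIV. \<Sum>m'\<in>UNIV. expectation (\<lambda>\<omega>. f m m' (X \<omega>)) *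
      (if m = m' then of_real s else 0)) = complex_of_real (s * c)"
    by (simp add: mult.commute)
  have "has_bochner_integral M (\<lambda>\<omega>. \<Sum>m\<in>UNIV. \<Sum>m'\<in>UNIV. f m m' (X \<omega>) * (Y \<omega> $ m * cnj (Y \<omega> $ m')))
      (\<Sum>m\<in>UNIV. \<Sum>m'\<in>UNIV. expectation (\<lambda>\<omega>. f m m' (X \<omega>)) * (if m = m' then of_real s else 0))"
    by (intro has_bochner_integral_sum bilinear)
  then have "has_bochner_integral M
      (\<lambda>\<omega>. complex_of_real ((cmod (herm_prod (X \<omega>) (Y \<omega>)))\<^sup>2 / norm (X \<omega>) ^ 4)) (complex_of_real (s * c))"
    unfolding expand val .
  from has_bochner_integral_Re[OF this] show ?thesis by simp
qed

end

subsection \<open>The rate bound\<close>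

text \<open>In natural logarithms the derivative is \<open>- 1 / (x\<^sup>2 + x)\<close>, whose own
  derivative is positive for \<open>x > 0\<close>.\<close>

lemma convex_on_log_one_plus_inverse: "convex_on {0<..} (\<lambda>x. log 2 (1 + 1 / x))"
proof (rule f''_ge0_imp_convex)
  fix x :: real assume "x \<in> {0<..}"
  then have x: "0 < x" "0 < 1 + 1 / x" by (auto simp: add_pos_pos)
  have "((\<lambda>x. ln (1 + 1 / x)) has_real_derivative - 1 / (x\<^sup>2 + x)) (at x)"
    using x by (auto intro!: derivative_eq_intros simp: field_simps power2_eq_square)
  from DERIV_cdivide[OF this, of "ln 2"]
  show "((\<lambda>x. log 2 (1 + 1 / x)) has_real_derivative - 1 / (ln 2 * (x\<^sup>2 + x))) (at x)"
    by (simp add: log_def mult.commute)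
  have "0 < x\<^sup>2 + x" using x by (simp add: add_pos_pos)
  then have "((\<lambda>x. - 1 / (x\<^sup>2 + x)) has_real_derivative (2 * x + 1) / (x\<^sup>2 + x)\<^sup>2) (at x)"
    by (auto intro!: derivative_eq_intros simp: power2_eq_square minus_divide_left simp del: divide_minus_left)
  from DERIV_cdivide[OF this, of "ln 2"]
  show "((\<lambda>x. - 1 / (ln 2 * (x\<^sup>2 + x))) has_real_derivative (2 * x + 1) / (ln 2 * (x\<^sup>2 + x)\<^sup>2)) (at x)"
    by (simp add: mult.commute)
  show "0 \<le> (2 * x + 1) / (ln 2 * (x\<^sup>2 + x)\<^sup>2)"
    using x by simp
qed simp

lemma aged_csi_nth:
  "aged_csi \<alpha> p \<beta> G B $ i =
    (\<alpha> * (p * \<beta> i / (1 + p * \<beta> i))) *\<^sub>R (G $ i) +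
    (\<alpha> * (p * \<beta> i / (1 + p * \<beta> i)) / sqrt p) *\<^sub>R (B $ i)"
  by (simp add: aged_csi_def mmse_estimate_def observation_def algebra_simps)

context prob_space
begin

text \<open>Jensen's inequality. The logarithm is integrable because
  \<open>ln (1 + y) \<le> y\<close> bounds it by \<open>1 / W\<close> up to the factor
  \<open>1 / ln 2\<close>.\<close>

lemma log_one_plus_inverse_expectation_le:
  assumes W: "integrable M W" "AE \<omega> in M. 0 < W \<omega>" and inv: "integrable M (\<lambda>\<omega>. 1 / W \<omega>)"
  shows "log 2 (1 + 1 / expectation W) \<le> expectation (\<lambda>\<omega>. log 2 (1 + 1 / W \<omega>))"
proof (rule jensens_inequality[OF W(1) _ _ _ convex_on_log_one_plus_inverse])
  have [measurable]: "random_variable borel W" using W(1) by simp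
  show "AE \<omega> in M. W \<omega> \<in> {0<..}" using W(2) by simp
  \<comment> \<open>The domain must have one of four interval shapes; the second one applies, and
    the endpoints in the others are fillers.\<close>
  show "{0<..} = {0<..<0} \<or> {0<..} = {0::real<..} \<or> {0<..} = {..<0::real} \<or> {0<..} = (UNIV :: real set)"
    by simp
  show "integrable M (\<lambda>\<omega>. log 2 (1 + 1 / W \<omega>))"
  proof (rule Bochner_Integration.integrable_bound)
    show "integrable M (\<lambda>\<omega>. 1 / W \<omega> / ln 2)" using inv by (intro integrable_divide_zero)
    show "AE \<omega> in M. norm (log 2 (1 + 1 / W \<omega>)) \<le> norm (1 / W \<omega> / ln 2)"
      using W(2)
    proof eventually_elim
      case (elim \<omega>)
      then have "ln (1 + 1 / W \<omega>) \<le> 1 / W \<omega>" "0 \<le> ln (1 + 1 / W \<omega>)"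
        by (auto intro!: ln_add_one_self_le_self)
      with elim divide_right_mono[OF this(1), of "ln 2"] show ?case
        by (simp add: log_def)
    qed
  qed simp
qed

section \<open>The joint law of the aged estimates\<close>

text \<open>Each entry is a combination of a channel entry and an independent noise entry with
  coefficients \<open>r\<close> and \<open>q\<close>. Since \<open>q = r / sqrt p\<close>, its
  variance is \<open>r\<^sup>2 * ((1 + p * \<beta> i) / p)\<close>, which cancels to the stated
  value.\<close>

lemma iid_complex_normal_aged_csi:
  fixes G B :: "'a \<Rightarrow> complex^'m^'k"
  assumes \<alpha>: "\<alpha> \<noteq> 0" and p: "0 < p" and \<beta>: "0 < \<beta> i"
    and G: "iid_complex_normal M (\<lambda>\<omega>. G \<omega> $ i) (\<beta> i)"
    and B: "iid_complex_normal M (\<lambda>\<omega>. B \<omega> $ i) 1"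
    and ind: "indep_var borel B borel G"
  shows "iid_complex_normal M (\<lambda>\<omega>. aged_csi \<alpha> p \<beta> (G \<omega>) (B \<omega>) $ i) (\<alpha>\<^sup>2 * (p * (\<beta> i)\<^sup>2 / (1 + p * \<beta> i)))"
  unfolding iid_complex_normal_def
proof (intro conjI allI)
  define r where "r = \<alpha> * (p * \<beta> i / (1 + p * \<beta> i))"
  define q where "q = r / sqrt p"
  have pb: "0 < 1 + p * \<beta> i" using p \<beta> by (simp add: add_pos_pos)
  have rq: "r \<noteq> 0" "q \<noteq> 0" using \<alpha> p \<beta> pb by (auto simp: r_def q_def)
  have aged: "aged_csi \<alpha> p \<beta> (G \<omega>) (B \<omega>) $ i $ m = r *\<^sub>R (G \<omega> $ i $ m) + q *\<^sub>R (B \<omega> $ i $ m)" for \<omega> m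
    by (simp add: aged_csi_nth r_def q_def)
  \<comment> \<open>Independence across antennas comes from pairing noise and channel entries
    antenna by antenna and then applying one fixed linear map to each pair.\<close>
  have "indep_vars (\<lambda>_. borel \<Otimes>\<^sub>M borel) (\<lambda>m \<omega>. (B \<omega> $ i $ m, G \<omega> $ i $ m)) UNIV"
    using G B unfolding iid_complex_normal_def
    by (intro indep_vars_Pair[where U = B and V = G and f = "\<lambda>m b. b $ i $ m" and h = "\<lambda>m g. g $ i $ m",
        OF _ _ _ _ _ ind]) auto
  from indep_vars_compose2[OF this, of "\<lambda>_ x. r *\<^sub>R snd x + q *\<^sub>R fst x" "\<lambda>_. borel"]
  show "indep_vars (\<lambda>_. borel) (\<lambda>m \<omega>. aged_csi \<alpha> p \<beta> (G \<omega>) (B \<omega>) $ i $ m) UNIV"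
    by (simp add: aged)
  fix m
  have "indep_var borel (\<lambda>\<omega>. B \<omega> $ i $ m) borel (\<lambda>\<omega>. G \<omega> $ i $ m)"
    using indep_var_compose[OF ind, of "\<lambda>b. b $ i $ m" borel "\<lambda>g. g $ i $ m" borel] by (simp add: comp_def)
  then have "distr M borel (\<lambda>\<omega>. q *\<^sub>R (B \<omega> $ i $ m) + r *\<^sub>R (G \<omega> $ i $ m)) = complex_normal (q\<^sup>2 * 1 + r\<^sup>2 * \<beta> i)"
    using G B \<beta> rq unfolding iid_complex_normal_def by (intro distr_complex_normal_sum) auto
  also have "q\<^sup>2 * 1 + r\<^sup>2 * \<beta> i = r\<^sup>2 * ((1 + p * \<beta> i) / p)"
    using p by (simp add: q_def power_divide field_simps)
  also have "\<dots> = \<alpha>\<^sup>2 * (p * (\<beta> i)\<^sup>2 / (1 + p * \<beta> i))"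
  proof -
    have "(\<alpha> * (p * x / u))\<^sup>2 * (u / p) = \<alpha>\<^sup>2 * (p * x\<^sup>2 / u)" if "0 < u" for u x
      using p that by (simp add: field_simps power2_eq_square)
    then show ?thesis using pb by (simp add: r_def)
  qed
  finally show "distr M borel (\<lambda>\<omega>. aged_csi \<alpha> p \<beta> (G \<omega>) (B \<omega>) $ i $ m) =
      complex_normal (\<alpha>\<^sup>2 * (p * (\<beta> i)\<^sup>2 / (1 + p * \<beta> i)))"
    by (simp add: aged add.commute)
qed

text \<open>The same pairing argument, with whole user vectors in place of antenna entries.\<close>

lemma indep_users_aged_csi:
  fixes G B :: "'a \<Rightarrow> complex^'m^'k"
  assumes G: "indep_users M G" and B: "indep_users M B" and ind: "indep_var borel B borel G"
  shows "indep_users M (\<lambda>\<omega>. aged_csi \<alpha> p \<beta> (G \<omega>) (B \<omega>))"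
proof -
  have "indep_vars (\<lambda>_. borel \<Otimes>\<^sub>M borel) (\<lambda>i \<omega>. (B \<omega> $ i, G \<omega> $ i)) UNIV"
    using G B unfolding indep_users_def
    by (intro indep_vars_Pair[where U = B and V = G and f = "\<lambda>i b. b $ i" and h = "\<lambda>i g. g $ i",
        OF _ _ _ _ _ ind]) auto
  from indep_vars_compose2[OF this, of "\<lambda>i x. (\<alpha> * (p * \<beta> i / (1 + p * \<beta> i))) *\<^sub>R snd x +
      (\<alpha> * (p * \<beta> i / (1 + p * \<beta> i)) / sqrt p) *\<^sub>R fst x" "\<lambda>_. borel"]
  show ?thesis
    unfolding indep_users_def by (simp add: aged_csi_nth)
qed

end

section \<open>The rate bound for independent Gaussian vectors and a general noise constant\<close>

lemma herm_prod_self: "herm_prod a a = of_real ((norm a)\<^sup>2)"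
  unfolding norm_vec_square of_real_sum complex_norm_square
  by (simp add: herm_prod_def mult.commute)

lemma borel_measurable_herm_prod [measurable (raw)]:
  assumes [measurable]: "X \<in> borel_measurable M" "Y \<in> borel_measurable M"
  shows "(\<lambda>\<omega>. herm_prod (X \<omega>) (Y \<omega>)) \<in> borel_measurable M"
  unfolding herm_prod_def by measurable

context prob_space
begin

text \<open>\<open>W\<close> is the reciprocal of the signal-to-interference-plus-noise ratio. Its
  expectation is explicit, and Jensen's inequality moves the expectation inside the logarithm.
  \<open>C\<close> collects receiver noise and channel uncertainty.\<close>

lemma expectation_log_mrc_ge:
  fixes Z :: "'a \<Rightarrow> complex^'m^'k"
  assumes iid: "\<And>i. iid_complex_normal M (\<lambda>\<omega>. Z \<omega> $ i) (s i)" and s: "\<And>i. 0 < s i"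
    and users: "indep_users M Z" and card: "2 \<le> CARD('m)" and p: "0 < p" and C: "0 < C"
  shows "log 2 (1 + p * (real CARD('m) - 1) * s k / (p * (\<Sum>i\<in>UNIV - {k}. s i) + C)) \<le>
    expectation (\<lambda>\<omega>. log 2 (1 + p * (cmod (herm_prod (Z \<omega> $ k) (Z \<omega> $ k)))\<^sup>2 /
      (p * (\<Sum>i\<in>UNIV - {k}. (cmod (herm_prod (Z \<omega> $ k) (Z \<omega> $ i)))\<^sup>2) + (norm (Z \<omega> $ k))\<^sup>2 * C)))"
proof -
  have [measurable]: "random_variable borel (\<lambda>\<omega>. Z \<omega> $ i)" for i
    using iid by (rule iid_complex_normal_measurable)
  let ?c = "1 / ((real CARD('m) - 1) * s k)"
  \<comment> \<open>Both parts of the reciprocal are divided by \<open>p\<close> times the fourth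
    power of the detector norm, the numerator of the ratio.\<close>
  define W where "W \<omega> = (\<Sum>i\<in>UNIV - {k}. (cmod (herm_prod (Z \<omega> $ k) (Z \<omega> $ i)))\<^sup>2 / norm (Z \<omega> $ k) ^ 4) +
    C / p * (1 / (norm (Z \<omega> $ k))\<^sup>2)" for \<omega>
  have [measurable]: "random_variable borel W"
    unfolding W_def by measurable
  have nz: "AE \<omega> in M. Z \<omega> $ k \<noteq> 0"
    using iid s card by (rule AE_iid_complex_normal_nonzero)
  have W_pos: "0 < W \<omega>" if "Z \<omega> $ k \<noteq> 0" for \<omega>
    unfolding W_def using that p C by (intro add_nonneg_pos sum_nonneg) auto
  have inv: "has_bochner_integral M (\<lambda>\<omega>. 1 / (norm (Z \<omega> $ k))\<^sup>2) ?c"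
    using iid s card by (rule has_bochner_integral_inverse_norm_square)
  have W: "has_bochner_integral M W ((\<Sum>i\<in>UNIV - {k}. s i * ?c) + C / p * ?c)"
    unfolding W_def
  proof (intro has_bochner_integral_add has_bochner_integral_sum has_bochner_integral_mult_right inv)
    fix i assume "i \<in> UNIV - {k}"
    then have "indep_var borel (\<lambda>\<omega>. Z \<omega> $ k) borel (\<lambda>\<omega>. Z \<omega> $ i)"
      using users unfolding indep_users_def by (intro indep_vars_imp_indep_var[where I = UNIV]) auto
    then show "has_bochner_integral M (\<lambda>\<omega>. (cmod (herm_prod (Z \<omega> $ k) (Z \<omega> $ i)))\<^sup>2 / norm (Z \<omega> $ k) ^ 4) (s i * ?c)"
      using iid less_imp_le[OF s] inv by (rule has_bochner_integral_herm_prod)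
  qed
  \<comment> \<open>Dropping the interference from \<open>W\<close> bounds \<open>1 / W\<close> by a
    multiple of the squared norm, whose expectation is finite.\<close>
  have W_bound: "1 / W \<omega> \<le> p / C * (norm (Z \<omega> $ k))\<^sup>2" if "Z \<omega> $ k \<noteq> 0" for \<omega>
  proof -
    have "C / p * (1 / (norm (Z \<omega> $ k))\<^sup>2) \<le> W \<omega>"
      unfolding W_def by (simp add: sum_nonneg)
    then have "1 / W \<omega> \<le> 1 / (C / p * (1 / (norm (Z \<omega> $ k))\<^sup>2))"
      using that p C by (intro frac_le) auto
    then show ?thesis by simp
  qed
  have "integrable M (\<lambda>\<omega>. 1 / W \<omega>)"
  proof (rule Bochner_Integration.integrable_bound)
    show "integrable M (\<lambda>\<omega>. p / C * (norm (Z \<omega> $ k))\<^sup>2)"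
      unfolding norm_vec_square
      using iid_complex_normal_moments(2)[OF iid less_imp_le[OF s], of k]
      by (intro integrable_mult_right Bochner_Integration.integrable_sum) (simp add: has_bochner_integral_iff)
    show "AE \<omega> in M. norm (1 / W \<omega>) \<le> norm (p / C * (norm (Z \<omega> $ k))\<^sup>2)"
      using nz
    proof eventually_elim
      case (elim \<omega>)
      have "norm (1 / W \<omega>) = 1 / W \<omega>" using W_pos[OF elim] by simp
      also note W_bound[OF elim]
      also have "p / C * (norm (Z \<omega> $ k))\<^sup>2 = norm (p / C * (norm (Z \<omega> $ k))\<^sup>2)"
        using p C by (simp add: abs_mult)
      finally show ?case .
    qed
  qed simp
  moreover have "AE \<omega> in M. 0 < W \<omega>"
    using nz by eventually_elim (rule W_pos)
  ultimately have "log 2 (1 + 1 / expectation W) \<le> expectation (\<lambda>\<omega>. log 2 (1 + 1 / W \<omega>))"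
    using W by (intro log_one_plus_inverse_expectation_le) (simp_all add: has_bochner_integral_iff)
  also have "1 / expectation W = p * (real CARD('m) - 1) * s k / (p * (\<Sum>i\<in>UNIV - {k}. s i) + C)"
  proof -
    have "expectation W = (\<Sum>i\<in>UNIV - {k}. s i * ?c) + C / p * ?c"
      using W by (simp add: has_bochner_integral_iff)
    also have "\<dots> = ((\<Sum>i\<in>UNIV - {k}. s i) + C / p) * ?c"
      by (simp only: sum_distrib_right distrib_right)
    also have "\<dots> = (p * (\<Sum>i\<in>UNIV - {k}. s i) + C) / (p * (real CARD('m) - 1) * s k)"
      using p by (simp add: field_simps)
    finally show ?thesis by simp
  qed
  also have "expectation (\<lambda>\<omega>. log 2 (1 + 1 / W \<omega>)) =
      expectation (\<lambda>\<omega>. log 2 (1 + p * (cmod (herm_prod (Z \<omega> $ k) (Z \<omega> $ k)))\<^sup>2 /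
        (p * (\<Sum>i\<in>UNIV - {k}. (cmod (herm_prod (Z \<omega> $ k) (Z \<omega> $ i)))\<^sup>2) + (norm (Z \<omega> $ k))\<^sup>2 * C)))"
  proof (rule integral_cong_AE)
    show "AE \<omega> in M. log 2 (1 + 1 / W \<omega>) =
      log 2 (1 + p * (cmod (herm_prod (Z \<omega> $ k) (Z \<omega> $ k)))\<^sup>2 /
        (p * (\<Sum>i\<in>UNIV - {k}. (cmod (herm_prod (Z \<omega> $ k) (Z \<omega> $ i)))\<^sup>2) + (norm (Z \<omega> $ k))\<^sup>2 * C))"
      using nz
    proof eventually_elim
      case (elim \<omega>)
      let ?n = "norm (Z \<omega> $ k)"
      let ?T = "\<Sum>i\<in>UNIV - {k}. (cmod (herm_prod (Z \<omega> $ k) (Z \<omega> $ i)))\<^sup>2"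
      have n: "0 < ?n" using elim by simp
      have "W \<omega> = ?T / ?n ^ 4 + C / p * (1 / ?n\<^sup>2)"
        unfolding W_def by (simp add: sum_divide_distrib)
      also have "\<dots> = (p * ?T + ?n\<^sup>2 * C) / (p * ?n ^ 4)"
        using n p by (simp add: add_frac_eq power2_eq_square power4_eq_xxxx) (simp add: field_simps)
      finally have "1 / W \<omega> = p * ?n ^ 4 / (p * ?T + ?n\<^sup>2 * C)" by simp
      moreover have "(cmod (herm_prod (Z \<omega> $ k) (Z \<omega> $ k)))\<^sup>2 = ?n ^ 4"
        unfolding herm_prod_self norm_of_real by simp
      ultimately show ?case by simp
    qed
  qed measurable
  finally show ?thesis .
qed

end

section \<open>Specialisation to the channel model\<close>

theorem theorem2:
  fixes P :: "'w measure"
    and p\<^sub>u p\<^sub>p \<alpha> b\<^sub>m\<^sub>r\<^sub>c :: real and \<tau> n :: nat and \<beta> :: "'k::finite \<Rightarrow> real"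
    and g b e :: "nat \<Rightarrow> 'w \<Rightarrow> complex^'m^'k"
    and k :: 'k
  assumes prob: "prob_space P"
    and users: "CARD('k) \<le> CARD('m)"
    and power: "p\<^sub>u > 0"
    and training: "CARD('k) \<le> \<tau>"
    and pilot_power: "p\<^sub>p = real \<tau> * p\<^sub>u"
    and fading: "\<And>i. \<beta> i > 0"
    and aging_coeff: "0 \<le> \<bar>\<alpha>\<bar>" "\<bar>\<alpha>\<bar> \<le> 1"
    and channel_law: "\<And>t i. t \<in> {n, Suc n} \<Longrightarrow> iid_complex_normal P (\<lambda>\<omega>. g t \<omega> $ i) (\<beta> i)"
    and channel_users: "\<And>t. t \<in> {n, Suc n} \<Longrightarrow> indep_users P (g t)"
    and noise_law: "\<And>i. iid_complex_normal P (\<lambda>\<omega>. b n \<omega> $ i) 1"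
    and noise_users: "indep_users P (b n)"
    and noise_channel: "prob_space.indep_var P borel (b n) borel (g n)"
    and innovation_law:
      "\<And>i. iid_complex_normal P (\<lambda>\<omega>. e (Suc n) \<omega> $ i) ((1 - \<alpha>\<^sup>2) * \<beta> i)"
    and innovation_indep:
      "\<And>i. indep_pair P borel (\<lambda>\<omega>. e (Suc n) \<omega> $ i) borel (\<lambda>\<omega>. (g n \<omega>, b n \<omega>))"
    and aging: "\<And>i \<omega>. \<omega> \<in> space P \<Longrightarrow> g (Suc n) \<omega> $ i = \<alpha> *\<^sub>R (g n \<omega> $ i) + e (Suc n) \<omega> $ i"
    and b_mrc: "b\<^sub>m\<^sub>r\<^sub>c = (1 - \<alpha>\<^sup>2) * real \<tau> * p\<^sub>u\<^sup>2 * (\<beta> k)\<^sup>2"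
  shows "achievable_rate P p\<^sub>u p\<^sub>p \<alpha> \<beta> mrc_receiver (\<lambda>\<omega>. aged_csi \<alpha> p\<^sub>p \<beta> (g n \<omega>) (b n \<omega>)) k
    \<ge> log 2 (1 + \<alpha>\<^sup>2 * real \<tau> * p\<^sub>u\<^sup>2 * (real CARD('m) - 1) * (\<beta> k)\<^sup>2 /
        (p\<^sub>u * (1 + real \<tau> * p\<^sub>u * \<beta> k) * (\<Sum>i\<in>UNIV - {k}. \<beta> i)
         + (real \<tau> + 1) * p\<^sub>u * \<beta> k + 1 + b\<^sub>m\<^sub>r\<^sub>c))"
proof -
  interpret prob_space P by (rule prob)
  define A where "A \<omega> = aged_csi \<alpha> p\<^sub>p \<beta> (g n \<omega>) (b n \<omega>)" for \<omega>
  \<comment> \<open>\<open>s i\<close> is the variance per entry of the aged estimate, and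
    \<open>C\<close> adds the total uncertainty left by estimation and aging, times the power, to
    the unit noise.\<close>
  define s where "s i = \<alpha>\<^sup>2 * (p\<^sub>p * (\<beta> i)\<^sup>2 / (1 + p\<^sub>p * \<beta> i))" for i
  define C where "C = p\<^sub>u * (\<Sum>i\<in>UNIV. \<beta> i - s i) + 1"
  have "0 < \<tau>" using training by (metis zero_less_card_finite less_le_trans)
  then have pp: "0 < p\<^sub>p" using power by (simp add: pilot_power)
  have pb: "0 < 1 + p\<^sub>p * \<beta> i" for i using pp fading by (simp add: add_pos_pos)
  \<comment> \<open>An aged estimate has no more variance than the channel, so every uncertainty
    term in \<open>C\<close> is nonnegative and \<open>C\<close> is positive.\<close>
  have s_le: "s i \<le> \<beta> i" for i
  proof -
    have "\<alpha>\<^sup>2 \<le> 1" using aging_coeff(2) by (simp add: abs_square_le_1)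
    moreover have "0 \<le> p\<^sub>p * (\<beta> i)\<^sup>2 / (1 + p\<^sub>p * \<beta> i)" using pp pb[of i] by simp
    ultimately have "s i \<le> 1 * (p\<^sub>p * (\<beta> i)\<^sup>2 / (1 + p\<^sub>p * \<beta> i))"
      unfolding s_def by (rule mult_right_mono)
    also have "\<dots> \<le> \<beta> i"
      using pp pb[of i] fading[of i] by (simp add: divide_le_eq power2_eq_square algebra_simps)
    finally show ?thesis .
  qed
  have C: "0 < C"
    unfolding C_def using power s_le by (intro add_nonneg_pos mult_nonneg_nonneg sum_nonneg) simp_all
  have rate: "achievable_rate P p\<^sub>u p\<^sub>p \<alpha> \<beta> mrc_receiver (\<lambda>\<omega>. aged_csi \<alpha> p\<^sub>p \<beta> (g n \<omega>) (b n \<omega>)) k =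
    expectation (\<lambda>\<omega>. log 2 (1 + p\<^sub>u * (cmod (herm_prod (A \<omega> $ k) (A \<omega> $ k)))\<^sup>2 /
      (p\<^sub>u * (\<Sum>i\<in>UNIV - {k}. (cmod (herm_prod (A \<omega> $ k) (A \<omega> $ i)))\<^sup>2) + (norm (A \<omega> $ k))\<^sup>2 * C)))"
    by (simp only: achievable_rate_def sinr_def mrc_receiver_def A_def[symmetric] s_def[symmetric] C_def[symmetric])
  show ?thesis
  \<comment> \<open>In the degenerate case the numerator of the bound vanishes, and it suffices that
    the rate is nonnegative.\<close>
  proof (cases "\<alpha> = 0 \<or> CARD('m) = 1")
    case True
    then have "\<alpha>\<^sup>2 * real \<tau> * p\<^sub>u\<^sup>2 * (real CARD('m) - 1) * (\<beta> k)\<^sup>2 = 0" by auto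
    moreover have "0 \<le> achievable_rate P p\<^sub>u p\<^sub>p \<alpha> \<beta> mrc_receiver (\<lambda>\<omega>. aged_csi \<alpha> p\<^sub>p \<beta> (g n \<omega>) (b n \<omega>)) k"
      unfolding rate
    proof (rule Bochner_Integration.integral_nonneg)
      fix \<omega>
      have "0 \<le> p\<^sub>u * (cmod (herm_prod (A \<omega> $ k) (A \<omega> $ k)))\<^sup>2 /
        (p\<^sub>u * (\<Sum>i\<in>UNIV - {k}. (cmod (herm_prod (A \<omega> $ k) (A \<omega> $ i)))\<^sup>2) + (norm (A \<omega> $ k))\<^sup>2 * C)"
        using power C by (intro divide_nonneg_nonneg add_nonneg_nonneg mult_nonneg_nonneg sum_nonneg) auto
      then show "0 \<le> log 2 (1 + p\<^sub>u * (cmod (herm_prod (A \<omega> $ k) (A \<omega> $ k)))\<^sup>2 /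
        (p\<^sub>u * (\<Sum>i\<in>UNIV - {k}. (cmod (herm_prod (A \<omega> $ k) (A \<omega> $ i)))\<^sup>2) + (norm (A \<omega> $ k))\<^sup>2 * C))"
        by simp
    qed
    ultimately show ?thesis by (simp only: div_0 add.right_neutral log_one)
  next
    case False
    then have \<alpha>: "\<alpha> \<noteq> 0" by simp
    have "0 < CARD('m)" by simp
    with False have card: "2 \<le> CARD('m)" by linarith
    have s: "0 < s i" for i unfolding s_def using \<alpha> pp pb[of i] fading[of i] by (intro mult_pos_pos divide_pos_pos) auto
    have iid: "iid_complex_normal P (\<lambda>\<omega>. A \<omega> $ i) (s i)" for i
      unfolding A_def s_def using \<alpha> pp fading channel_law noise_law noise_channel
      by (intro iid_complex_normal_aged_csi) auto
    have users: "indep_users P A"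
      unfolding A_def using channel_users noise_users noise_channel
      by (intro indep_users_aged_csi) auto
    \<comment> \<open>The interference through the estimates and the uncertainty of the other users
      add up to their full \<beta>; only the estimate variance of user \<open>k\<close> remains
      subtracted.\<close>
    have C_eq: "p\<^sub>u * (\<Sum>i\<in>UNIV - {k}. s i) + C = p\<^sub>u * (\<Sum>i\<in>UNIV - {k}. \<beta> i) + p\<^sub>u * (\<beta> k - s k) + 1"
      unfolding C_def by (simp add: sum.remove[of UNIV k] sum_subtractf algebra_simps)
    have sk: "s k * (1 + p\<^sub>p * \<beta> k) = \<alpha>\<^sup>2 * p\<^sub>p * (\<beta> k)\<^sup>2"
      using pb[of k] by (simp add: s_def)
    \<comment> \<open>Expanding the fraction by \<open>1 + p\<^sub>p * \<beta> k\<close> clears the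
      denominator hidden in \<open>s k\<close>.\<close>
    have "p\<^sub>u * (real CARD('m) - 1) * s k / (p\<^sub>u * (\<Sum>i\<in>UNIV - {k}. s i) + C) =
        p\<^sub>u * (real CARD('m) - 1) * s k * (1 + p\<^sub>p * \<beta> k) /
        ((p\<^sub>u * (\<Sum>i\<in>UNIV - {k}. s i) + C) * (1 + p\<^sub>p * \<beta> k))"
      using pb[of k] by simp
    also have "p\<^sub>u * (real CARD('m) - 1) * s k * (1 + p\<^sub>p * \<beta> k) =
        \<alpha>\<^sup>2 * real \<tau> * p\<^sub>u\<^sup>2 * (real CARD('m) - 1) * (\<beta> k)\<^sup>2"
      using sk by (simp add: mult.assoc) (simp add: pilot_power power2_eq_square)
    also have "(p\<^sub>u * (\<Sum>i\<in>UNIV - {k}. s i) + C) * (1 + p\<^sub>p * \<beta> k) =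
        p\<^sub>u * (1 + p\<^sub>p * \<beta> k) * (\<Sum>i\<in>UNIV - {k}. \<beta> i) +
        (p\<^sub>u * \<beta> k * (1 + p\<^sub>p * \<beta> k) - p\<^sub>u * (s k * (1 + p\<^sub>p * \<beta> k)) + (1 + p\<^sub>p * \<beta> k))"
      unfolding C_eq by (simp add: algebra_simps)
    \<comment> \<open>The linear terms in \<open>\<beta> k\<close> combine to the factor
      \<open>real \<tau> + 1\<close>, and the difference of the two quadratic terms is
      \<open>b\<^sub>m\<^sub>r\<^sub>c\<close>.\<close>
    also have "\<dots> = p\<^sub>u * (1 + real \<tau> * p\<^sub>u * \<beta> k) * (\<Sum>i\<in>UNIV - {k}. \<beta> i)
         + (real \<tau> + 1) * p\<^sub>u * \<beta> k + 1 + b\<^sub>m\<^sub>r\<^sub>c"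
      unfolding sk by (simp add: b_mrc pilot_power power2_eq_square algebra_simps)
    finally show ?thesis
      unfolding rate using expectation_log_mrc_ge[OF iid s users card power C, of k] by simp
  qed
qed

end
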